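(* Let $f \in \mathbb{Q}[x]$ be a square-free polynomial and let $[a,b]$, with $a<b$ and $ab>0$, be a closed interval belonging to a monotonic convex isolation of $f$. Let $\xi$ be the only real root of $f$ in $[a,b]$. Define $(x_0,c_0)=(a,b)$ if $f(a)f''(a)>0$, and $(x_0,c_0)=(b,a)$ otherwise, and for $i=0,1,2,\ldots$ put $$x_{i+1}=x_i-\frac{f(x_i)}{f'(x_i)},\qquad c_{i+1}=\frac{x_i f(c_i)-c_i f(x_i)}{f(c_i)-f(x_i)}.$$ Then this iteration (the iteration of Algorithm LZ1) converges (to $\xi$), and its convergence rate is at least $2$.
   Context: A real root isolation of a square-free polynomial $f$ is a finite collection of pairwise disjoint closed intervals with rational endpoints (degenerate point intervals $[r,r]$ are allowed) such that each interval contains exactly one real root of $f$ and every real root of $f$ lies in one of the intervals. A real root isolation $Iso$ of a square-free polynomial $f\in\mathbb{Q}[x]$ is called a monotonic convex isolation of $f$ if, for every $I\in Iso$ that is not a point, $f'(x)\neq 0$ and $f''(x)\neq 0$ for all $x\in I$. Algorithm LZ1 takes $[a,b]$ and a positive integer $L$ and refines $[a,b]$ to a narrow interval containing $\xi$ by running the stated iteration (a Newton step at $x_i$ and a secant step through $x_i,c_i$); the $i$-th interval is $[\min(x_i,c_i),\max(x_i,c_i)]$, and the algorithm stops once $|x_i-c_i|\le 10^{-L}\min(|x_i|,|c_i|)$. The statement concerns the iteration continued indefinitely. Convergence of the iteration means $x_i\to\xi$ and $c_i\to\xi$. The convergence rate is that of the sequence of interval lengths $\ell_i=|x_i-c_i|$: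 rate at least $p$ means that $\ell_i\to 0$ and there is a constant $C$ with $\ell_{i+1}\le C\,\ell_i^{\,p}$ for all sufficiently large $i$.
   Formalization: The case ξ=a with f(b)f''(b)<0 is excluded: the rule then starts Newton on the wrong side and the claim can fail, e.g. f=(x-1)(3-x)(x+2) on [1,2], where x_1=-2 is another root. If x_i=c_i, where the secant formula is 0/0, c_{i+1}=c_i is taken. *)

theory Defs
  imports
    "HOL-Analysis.Analysis"
    "HOL-Computational_Algebra.Polynomial"
    "HOL-Computational_Algebra.Squarefree"
begin

abbreviation real_poly_of :: "rat poly \<Rightarrow> real poly" where
  "real_poly_of f \<equiv> map_poly real_of_rat f"

definition real_root_isolation :: "rat poly \<Rightarrow> real set set \<Rightarrow> bool" where
  "real_root_isolation f Iso \<longleftrightarrow>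
     finite Iso \<and>
     (\<forall>I\<in>Iso. \<exists>l u :: rat. l \<le> u \<and> I = {real_of_rat l..real_of_rat u}) \<and>
     pairwise disjnt Iso \<and>
     (\<forall>I\<in>Iso. \<exists>!r. r \<in> I \<and> poly (real_poly_of f) r = 0) \<and>
     (\<forall>r. poly (real_poly_of f) r = 0 \<longrightarrow> (\<exists>I\<in>Iso. r \<in> I))"

definition monotonic_convex_isolation :: "rat poly \<Rightarrow> real set set \<Rightarrow> bool" where
  "monotonic_convex_isolation f Iso \<longleftrightarrow>
     real_root_isolation f Iso \<and>
     (\<forall>I\<in>Iso. (\<nexists>r. I = {r}) \<longrightarrow>
        (\<forall>x\<in>I. poly (pderiv (real_poly_of f)) x \<noteq> 0 \<and>
               poly (pderiv (pderiv (real_poly_of f))) x \<noteq> 0))"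

definition lz1_start :: "real poly \<Rightarrow> real \<Rightarrow> real \<Rightarrow> real \<times> real" where
  "lz1_start p a b =
     (if poly p a * poly (pderiv (pderiv p)) a > 0 then (a, b) else (b, a))"

definition newton_step :: "real poly \<Rightarrow> real \<Rightarrow> real" where
  "newton_step p x = x - poly p x / poly (pderiv p) x"

text \<open>
  If the two points coincide, the enclosing interval is a single point and the secant
  formula reads 0/0; the point is then kept. On a monotonic convex interval this happens
  only if the starting point of the Newton iteration is already the root.
\<close>

definition secant_step :: "real poly \<Rightarrow> real \<Rightarrow> real \<Rightarrow> real" where
  "secant_step p x c =
     (if x = c then c
      else (x * poly p c - c * poly p x) / (poly p c - poly p x))"

fun lz1_iter :: "real poly \<Rightarrow> real \<Rightarrow> real \<Rightarrow> nat \<Rightarrow> real \<times> real" where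
  "lz1_iter p a b 0 = lz1_start p a b"
| "lz1_iter p a b (Suc i) =
     (let (x, c) = lz1_iter p a b i in (newton_step p x, secant_step p x c))"

text \<open>No division by zero occurs in the Newton and secant formulas.\<close>

definition lz1_well_defined :: "real poly \<Rightarrow> real \<Rightarrow> real \<Rightarrow> bool" where
  "lz1_well_defined p a b \<longleftrightarrow>
     (\<forall>i. let (x, c) = lz1_iter p a b i in
        poly (pderiv p) x \<noteq> 0 \<and> (x \<noteq> c \<longrightarrow> poly p c \<noteq> poly p x))"

definition convergence_rate_at_least :: "real \<Rightarrow> (nat \<Rightarrow> real) \<Rightarrow> bool" where
  "convergence_rate_at_least q l \<longleftrightarrow>
     l \<longlonglongrightarrow> 0 \<and> (\<exists>C. \<forall>\<^sub>F i in sequentially. l (Suc i) \<le> C * l i powr q)"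

end

theory Submission
  imports Defs
begin

text \<open>
  Write \<open>p = (X - \<xi>) q\<close>. Since \<open>p' = q + (X - \<xi>) q'\<close>, the errors of one Newton step and one
  secant step are
  \<open>(x - \<xi>)\<^sup>2 q'(x) / p'(x)\<close> and \<open>(x - \<xi>) (c - \<xi>) q'(\<eta>) / p'(\<zeta>)\<close>,
  where \<open>q'\<close> has the sign of \<open>p''\<close>. Hence the \<open>x\<^sub>i\<close> stay on the side of \<open>\<xi>\<close> given by the sign
  \<open>s\<close> of \<open>p' p''\<close>, the \<open>c\<^sub>i\<close> stay on the other side, and the interval length
  \<open>\<bar>x - \<xi>\<bar> + \<bar>c - \<xi>\<bar>\<close> is squared up to a constant. On the other hand both steps multiply the
  error by \<open>1 - p'(\<theta>) / p'(\<zeta>)\<close> for some \<open>\<theta>\<close>, \<open>\<zeta>\<close>, which is bounded away from \<open>1\<close>, so both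
  sequences converge at least geometrically.
\<close>

section \<open>Mean values and constancy of sign for real polynomials\<close>

lemma poly_mvt_segment:
  fixes p :: "real poly"
  shows "\<exists>z\<in>closed_segment x y. poly p x - poly p y = (x - y) * poly (pderiv p) z"
proof (cases x y rule: linorder_cases)
  case less
  from poly_MVT[OF less, of p] obtain z where "x < z" "z < y"
    "poly p y - poly p x = (y - x) * poly (pderiv p) z" by auto
  with less show ?thesis
    by (intro bexI[of _ z]) (auto simp: closed_segment_eq_real_ivl algebra_simps)
next
  case greater
  from poly_MVT[OF greater, of p] obtain z where "y < z" "z < x"
    "poly p x - poly p y = (x - y) * poly (pderiv p) z" by auto
  with greater show ?thesis
    by (intro bexI[of _ z]) (auto simp: closed_segment_eq_real_ivl)
\<comment> \<open>For \<open>x = y\<close> both sides vanish. Covering this case spares later uses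
  any ordering of the two points.\<close>
qed auto

text \<open>The intermediate value theorem forbids a sign change. The product is symmetric in
  \<open>x\<close> and \<open>y\<close>, so \<open>x \<le> y\<close> may be assumed.\<close>

lemma poly_nonzero_same_sign:
  fixes p :: "real poly"
  assumes nz: "\<And>x. x \<in> {l..u} \<Longrightarrow> poly p x \<noteq> 0" and "x \<in> {l..u}" "y \<in> {l..u}"
  shows "0 < poly p x * poly p y"
  using assms(2,3)
proof (induction x y rule: linorder_wlog)
  case (le x y)
  show ?case
  proof (rule ccontr)
    assume "\<not> 0 < poly p x * poly p y"
    moreover from nz le have "poly p x * poly p y \<noteq> 0" by simp
    ultimately have neg: "poly p x * poly p y < 0" by linarith
    then have "x \<noteq> y" by (auto simp: not_less[symmetric])
    with le have "x < y" by simp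
    from poly_IVT[OF this neg] obtain z where "x < z" "z < y" "poly p z = 0" by auto
    with nz[of z] le show False by auto
  qed
qed (simp add: mult.commute)

section \<open>A root of a polynomial with nonvanishing first two derivatives\<close>

locale monotone_convex_root =
  fixes p q :: "real poly" and l u \<xi> :: real
  assumes factor: "p = [:-\<xi>, 1:] * q"
    and root_in: "\<xi> \<in> {l..u}"
    and deriv_nz: "\<And>x. x \<in> {l..u} \<Longrightarrow> poly (pderiv p) x \<noteq> 0"
    and deriv2_nz: "\<And>x. x \<in> {l..u} \<Longrightarrow> poly (pderiv (pderiv p)) x \<noteq> 0"
begin

abbreviation "p' \<equiv> poly (pderiv p)"
abbreviation "p'' \<equiv> poly (pderiv (pderiv p))"
abbreviation "q' \<equiv> poly (pderiv q)"

definition s :: real where "s = sgn (p' \<xi> * p'' \<xi>)"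

lemma poly_p: "poly p x = (x - \<xi>) * poly q x"
  by (simp add: factor algebra_simps)

lemma p'_eq: "p' x = poly q x + (x - \<xi>) * q' x"
  unfolding factor pderiv_mult by (simp add: pderiv_pCons algebra_simps)

lemma p''_root: "p'' \<xi> = 2 * q' \<xi>"
  unfolding factor pderiv_mult by (simp add: pderiv_pCons pderiv_add pderiv_diff pderiv_smult)

lemma mvt:
  assumes "x \<in> {l..u}" "y \<in> {l..u}"
  obtains z where "z \<in> {l..u}" "poly r x - poly r y = (x - y) * poly (pderiv r) z"
proof -
  obtain z where z: "z \<in> closed_segment x y" "poly r x - poly r y = (x - y) * poly (pderiv r) z"
    using poly_mvt_segment by blast
  moreover have "z \<in> {l..u}"
    using z(1) assms by (auto simp: closed_segment_eq_real_ivl split: if_splits)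
  ultimately show ?thesis using that by blast
qed

lemma mvt_root:
  assumes "x \<in> {l..u}"
  obtains z where "z \<in> {l..u}" "poly p x = (x - \<xi>) * p' z"
  using mvt[OF assms root_in, of p] by (auto simp: poly_p)

section \<open>Signs of the derivatives and of the cofactor's derivative\<close>

lemma p'_same_sign: "x \<in> {l..u} \<Longrightarrow> y \<in> {l..u} \<Longrightarrow> 0 < p' x * p' y"
  using poly_nonzero_same_sign deriv_nz by blast

lemma p''_same_sign: "x \<in> {l..u} \<Longrightarrow> y \<in> {l..u} \<Longrightarrow> 0 < p'' x * p'' y"
  using poly_nonzero_same_sign deriv2_nz by blast

lemma s_cases: "s = 1 \<or> s = -1"
  using deriv_nz[OF root_in] deriv2_nz[OF root_in] by (auto simp: s_def sgn_real_def)

text \<open>For \<open>x\<close> distinct from \<xi>, some \<theta> between them has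
  \<open>q(x) = p'(\<theta>)\<close>. Hence \<open>(x - \<xi>) q'(x) = p'(x) - p'(\<theta>) = (x -
  \<theta>) p''(\<eta>)\<close>, and \<open>x - \<theta>\<close> is zero or has the sign of
  \<open>x - \<xi>\<close>.\<close>

lemma q'_sign:
  assumes "x \<in> {l..u}"
  shows "0 \<le> p'' \<xi> * q' x"
proof (cases "x = \<xi>")
  case True
  then show ?thesis using p''_root by simp
next
  case False
  obtain \<theta> where \<theta>: "\<theta> \<in> closed_segment x \<xi>" "poly p x = (x - \<xi>) * p' \<theta>"
    using poly_mvt_segment[of x \<xi> p] by (auto simp: poly_p)
  then have "\<theta> \<in> {l..u}" and side: "0 \<le> (x - \<theta>) * (x - \<xi>)"
    using assms root_in
    by (auto simp: closed_segment_eq_real_ivl mult_nonpos_nonpos split: if_splits)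
  then obtain \<eta> where \<eta>: "\<eta> \<in> {l..u}" "p' x - p' \<theta> = (x - \<theta>) * p'' \<eta>"
    using mvt[OF assms] by blast
  have "(x - \<xi>)\<^sup>2 * q' x = (x - \<xi>) * (p' x - p' \<theta>)"
    using \<theta>(2) by (simp add: poly_p p'_eq[of x] power2_eq_square algebra_simps)
  then have "p'' \<xi> * ((x - \<xi>)\<^sup>2 * q' x) = p'' \<xi> * ((x - \<xi>) * ((x - \<theta>) * p'' \<eta>))"
    unfolding \<eta>(2) by simp
  then have "(x - \<xi>)\<^sup>2 * (p'' \<xi> * q' x) = ((x - \<theta>) * (x - \<xi>)) * (p'' \<xi> * p'' \<eta>)"
    by (simp only: mult_ac)
  also have "\<dots> \<ge> 0"
    using side p''_same_sign[OF root_in \<eta>(1)] by simp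
  finally show ?thesis
    using False by (simp add: zero_le_mult_iff)
qed

text \<open>This quotient is the factor in the error formulas of both steps, so it decides on which
  side of \<xi> the new points fall.\<close>

lemma s_quotient_nonneg:
  assumes "y \<in> {l..u}" "z \<in> {l..u}"
  shows "0 \<le> s * (q' y / p' z)"
  using q'_sign[OF assms(1)] p'_same_sign[OF root_in assms(2)]
  by (auto simp: s_def sgn_mult sgn_real_def zero_le_mult_iff zero_less_mult_iff
      zero_le_divide_iff divide_le_0_iff)

text \<open>Since \<open>p(x)\<close> is \<open>x - \<xi>\<close> times a value of
  \<open>p'\<close>, the test in \<open>lz1_start\<close> tells whether a point lies on the side of
  \<xi> selected by \<open>s\<close>.\<close>

lemma p_p''_sign:
  assumes "x \<in> {l..u}"
  shows "sgn (poly p x * p'' x) = s * sgn (x - \<xi>)"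
proof -
  obtain z where z: "z \<in> {l..u}" "poly p x = (x - \<xi>) * p' z"
    using mvt_root[OF assms] by blast
  have "sgn (p' z) = sgn (p' \<xi>)" "sgn (p'' x) = sgn (p'' \<xi>)"
    using p'_same_sign[OF root_in z(1)] p''_same_sign[OF root_in assms]
    by (auto simp: zero_less_mult_iff)
  then show ?thesis
    by (simp add: z(2) s_def sgn_mult)
qed

section \<open>Uniform bounds by compactness\<close>

lemma square_compact: "compact ({l..u} \<times> {l..u})" "{l..u} \<times> {l..u} \<noteq> {}"
  using root_in by (auto intro: compact_Times)

text \<open>The mean value theorem yields unrelated points in numerator and denominator, hence a
  minimum over the whole square. It is positive because \<open>p'\<close> keeps its sign.\<close>

lemma p'_quotient_lower_bound:
  obtains \<kappa> where "0 < \<kappa>" "\<And>y z. y \<in> {l..u} \<Longrightarrow> z \<in> {l..u} \<Longrightarrow> \<kappa> \<le> p' y / p' z"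
proof -
  have "continuous_on ({l..u} \<times> {l..u}) (\<lambda>w. p' (fst w) / p' (snd w))"
    using deriv_nz by (intro continuous_intros) auto
  from continuous_attains_inf[OF square_compact this]
  obtain y0 z0 where w: "y0 \<in> {l..u}" "z0 \<in> {l..u}"
    and min: "\<forall>v\<in>{l..u} \<times> {l..u}. p' y0 / p' z0 \<le> p' (fst v) / p' (snd v)"
    by (metis mem_Times_iff)
  show ?thesis
  proof (rule that)
    show "0 < p' y0 / p' z0"
      using p'_same_sign[OF w] by (simp add: zero_less_mult_iff zero_less_divide_iff)
    show "p' y0 / p' z0 \<le> p' y / p' z" if "y \<in> {l..u}" "z \<in> {l..u}" for y z
      using bspec[OF min SigmaI[OF that]] by simp
  qed
qed

text \<open>\<open>K\<close> becomes the constant of the quadratic rate.\<close>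

lemma q'_p'_quotient_upper_bound:
  obtains K where "\<And>y z. y \<in> {l..u} \<Longrightarrow> z \<in> {l..u} \<Longrightarrow> \<bar>q' y / p' z\<bar> \<le> K"
proof -
  have "continuous_on ({l..u} \<times> {l..u}) (\<lambda>w. \<bar>q' (fst w) / p' (snd w)\<bar>)"
    using deriv_nz by (intro continuous_intros) auto
  from continuous_attains_sup[OF square_compact this]
  obtain K where max: "\<forall>v\<in>{l..u} \<times> {l..u}. \<bar>q' (fst v) / p' (snd v)\<bar> \<le> K"
    by blast
  show ?thesis
  proof (rule that)
    show "\<bar>q' y / p' z\<bar> \<le> K" if "y \<in> {l..u}" "z \<in> {l..u}" for y z
      using bspec[OF max SigmaI[OF that]] by simp
  qed
qed

section \<open>Error formulas for the two steps\<close>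

lemma newton_step_error:
  assumes "x \<in> {l..u}"
  shows "newton_step p x - \<xi> = (x - \<xi>)\<^sup>2 * (q' x / p' x)"
    and "\<exists>\<theta>\<in>{l..u}. \<exists>\<zeta>\<in>{l..u}. newton_step p x - \<xi> = (x - \<xi>) * (1 - p' \<theta> / p' \<zeta>)"
proof -
  have "(newton_step p x - \<xi>) * p' x = (x - \<xi>) * p' x - poly p x"
    using deriv_nz[OF assms] by (simp add: newton_step_def field_simps)
  also have "\<dots> = (x - \<xi>)\<^sup>2 * q' x"
    by (simp add: poly_p p'_eq power2_eq_square algebra_simps)
  finally show "newton_step p x - \<xi> = (x - \<xi>)\<^sup>2 * (q' x / p' x)"
    using deriv_nz[OF assms] by (simp add: field_simps)
  obtain \<theta> where "\<theta> \<in> {l..u}" "poly p x = (x - \<xi>) * p' \<theta>"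
    using mvt_root[OF assms] by blast
  \<comment> \<open>The Newton slope is taken at \<open>x\<close> itself, so \<zeta> is
    \<open>x\<close>.\<close>
  then show "\<exists>\<theta>\<in>{l..u}. \<exists>\<zeta>\<in>{l..u}. newton_step p x - \<xi> = (x - \<xi>) * (1 - p' \<theta> / p' \<zeta>)"
    using assms by (intro bexI[of _ \<theta>] bexI[of _ x]) (auto simp: newton_step_def algebra_simps)
qed

text \<open>Ensures that the secant denominator vanishes only when the two points coincide.\<close>

lemma poly_p_inj:
  assumes "x \<in> {l..u}" "c \<in> {l..u}" "x \<noteq> c"
  shows "poly p c \<noteq> poly p x"
proof -
  obtain z where "z \<in> {l..u}" "poly p c - poly p x = (c - x) * p' z"
    using mvt assms by blast
  with deriv_nz[of z] assms(3) show ?thesis by auto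
qed

text \<open>The first form gives the side of the new point and the quadratic bound, the second the
  contraction of \<open>c\<close>.\<close>

lemma secant_step_error:
  assumes x: "x \<in> {l..u}" and c: "c \<in> {l..u}" and "x \<noteq> c"
  shows "\<exists>\<eta>\<in>{l..u}. \<exists>\<zeta>\<in>{l..u}. secant_step p x c - \<xi> = (x - \<xi>) * (c - \<xi>) * (q' \<eta> / p' \<zeta>)"
    and "\<exists>\<theta>\<in>{l..u}. \<exists>\<zeta>\<in>{l..u}. secant_step p x c - \<xi> = (c - \<xi>) * (1 - p' \<theta> / p' \<zeta>)"
proof -
  obtain \<zeta> where \<zeta>: "\<zeta> \<in> {l..u}" "poly p c - poly p x = (c - x) * p' \<zeta>"
    using mvt[OF c x] by blast
  obtain \<eta> where \<eta>: "\<eta> \<in> {l..u}" "poly q c - poly q x = (c - x) * q' \<eta>"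
    using mvt[OF c x] by blast
  obtain \<theta> where \<theta>: "\<theta> \<in> {l..u}" "poly p c = (c - \<xi>) * p' \<theta>"
    using mvt_root[OF c] by blast
  have nz: "(c - x) * p' \<zeta> \<noteq> 0"
    using deriv_nz[OF \<zeta>(1)] assms(3) by simp
  have eq: "secant_step p x c = (x * poly p c - c * poly p x) / ((c - x) * p' \<zeta>)"
    using assms(3) by (simp add: secant_step_def \<zeta>(2))
  have mult_denom: "secant_step p x c * ((c - x) * p' \<zeta>) = x * poly p c - c * poly p x"
    unfolding eq by (rule nonzero_eq_divide_eq[OF nz, THEN iffD1, OF refl])
  have "(secant_step p x c - \<xi>) * ((c - x) * p' \<zeta>)
      = x * poly p c - c * poly p x - \<xi> * (poly p c - poly p x)"
    by (simp only: left_diff_distrib[of "secant_step p x c"] mult_denom \<zeta>(2))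
  \<comment> \<open>The left side is \<open>(x - \<xi>) p(c) - (c - \<xi>) p(x)\<close>; inserting
    \<open>p = (X - \<xi>) q\<close> exposes a difference of values of \<open>q\<close>.\<close>
  also have "\<dots> = (x - \<xi>) * (c - \<xi>) * (poly q c - poly q x)"
    by (simp add: poly_p algebra_simps)
  finally have "(c - x) * ((secant_step p x c - \<xi>) * p' \<zeta>) = (c - x) * ((x - \<xi>) * (c - \<xi>) * q' \<eta>)"
    unfolding \<eta>(2) by (simp only: mult_ac)
  then have "(secant_step p x c - \<xi>) * p' \<zeta> = (x - \<xi>) * (c - \<xi>) * q' \<eta>"
    using assms(3) by simp
  then have "secant_step p x c - \<xi> = (x - \<xi>) * (c - \<xi>) * (q' \<eta> / p' \<zeta>)"
    using deriv_nz[OF \<zeta>(1)] by (simp add: eq_divide_eq)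
  with \<zeta>(1) \<eta>(1) show "\<exists>\<eta>\<in>{l..u}. \<exists>\<zeta>\<in>{l..u}.
      secant_step p x c - \<xi> = (x - \<xi>) * (c - \<xi>) * (q' \<eta> / p' \<zeta>)" by blast
  \<comment> \<open>Measured from \<open>c\<close>, the secant step is a Newton-like step with slope
    \<open>p'(\<zeta>)\<close> in place of \<open>p'(c)\<close>.\<close>
  have "(secant_step p x c - c) * ((c - x) * p' \<zeta>)
      = x * poly p c - c * poly p x - c * (poly p c - poly p x)"
    by (simp only: left_diff_distrib[of "secant_step p x c"] mult_denom \<zeta>(2))
  also have "\<dots> = - ((c - \<xi>) * p' \<theta>) * (c - x)"
    by (simp add: \<theta>(2) algebra_simps)
  finally have "(c - x) * ((secant_step p x c - c) * p' \<zeta>) = (c - x) * - ((c - \<xi>) * p' \<theta>)"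
    by (simp only: mult_ac)
  then have "(secant_step p x c - c) * p' \<zeta> = - ((c - \<xi>) * p' \<theta>)"
    using assms(3) by (subst (asm) mult_cancel_left) simp
  then have "secant_step p x c - c = - ((c - \<xi>) * (p' \<theta> / p' \<zeta>))"
    using deriv_nz[OF \<zeta>(1)] by (simp add: field_simps)
  then have "secant_step p x c - \<xi> = (c - \<xi>) * (1 - p' \<theta> / p' \<zeta>)"
    by (simp add: right_diff_distrib)
  with \<zeta>(1) \<theta>(1) show "\<exists>\<theta>\<in>{l..u}. \<exists>\<zeta>\<in>{l..u}.
      secant_step p x c - \<xi> = (c - \<xi>) * (1 - p' \<theta> / p' \<zeta>)" by blast
qed

section \<open>The invariant: a pair of points enclosing the root\<close>

definition bracket :: "real \<Rightarrow> real \<Rightarrow> bool" where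
  "bracket x c \<longleftrightarrow> x \<in> {l..u} \<and> c \<in> {l..u} \<and> 0 \<le> s * (x - \<xi>) \<and> s * (c - \<xi>) \<le> 0"

text \<open>The points lie on opposite sides of \<xi>, either of them possibly equal to it, so the
  distances add up.\<close>

lemma bracket_length: "bracket x c \<Longrightarrow> \<bar>x - c\<bar> = \<bar>x - \<xi>\<bar> + \<bar>c - \<xi>\<bar>"
  using s_cases by (auto simp: bracket_def)

lemma bracket_refl: "bracket x x \<Longrightarrow> x = \<xi>"
  using s_cases by (auto simp: bracket_def)

lemma bracket_root: "bracket \<xi> \<xi>"
  using root_in by (simp add: bracket_def)

lemma steps_root: "newton_step p \<xi> = \<xi>" "secant_step p \<xi> \<xi> = \<xi>"
  by (simp_all add: newton_step_def secant_step_def poly_p)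

text \<open>The bound \<open>t \<le> 1\<close> comes from \<open>side\<close>: a larger
  \<open>t\<close> would carry \<open>y\<close> across the root. Thus \<open>y\<close> lies between
  \<xi> and \<open>x\<close>, hence in the interval.\<close>

lemma contraction_towards_root:
  assumes "x \<in> {l..u}" and y: "y - \<xi> = (x - \<xi>) * (1 - t)" and "0 < \<kappa>" "\<kappa> \<le> t"
    and side: "0 \<le> (x - \<xi>) * (y - \<xi>)"
  shows "y \<in> {l..u}" "\<bar>y - \<xi>\<bar> \<le> (1 - \<kappa>) * \<bar>x - \<xi>\<bar>"
proof -
  have "y \<in> {l..u} \<and> \<bar>y - \<xi>\<bar> \<le> (1 - \<kappa>) * \<bar>x - \<xi>\<bar>"
  proof (cases "x = \<xi>")
    case True
    with y root_in show ?thesis by simp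
  next
    case False
    have "0 \<le> (x - \<xi>)\<^sup>2 * (1 - t)"
      using side unfolding y by (simp add: power2_eq_square mult.assoc)
    with False have "t \<le> 1"
      by (simp add: zero_le_mult_iff)
    then have abs_y: "\<bar>y - \<xi>\<bar> = (1 - t) * \<bar>x - \<xi>\<bar>"
      by (simp add: y abs_mult mult.commute)
    also have "\<dots> \<le> (1 - \<kappa>) * \<bar>x - \<xi>\<bar>"
      using assms(4) by (intro mult_right_mono) auto
    also have "\<dots> \<le> 1 * \<bar>x - \<xi>\<bar>"
      using assms(3) by (intro mult_right_mono) auto
    finally have "\<bar>y - \<xi>\<bar> \<le> \<bar>x - \<xi>\<bar>" by simp
    with side assms(1) root_in have "y \<in> {l..u}"
      by (auto simp: zero_le_mult_iff)
    moreover have "\<bar>y - \<xi>\<bar> \<le> (1 - \<kappa>) * \<bar>x - \<xi>\<bar>"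
      unfolding abs_y using assms(4) by (intro mult_right_mono) auto
    ultimately show ?thesis by blast
  qed
  then show "y \<in> {l..u}" "\<bar>y - \<xi>\<bar> \<le> (1 - \<kappa>) * \<bar>x - \<xi>\<bar>" by simp_all
qed

text \<open>The error formulas with \<open>q'\<close> fix the sides first; the sides then make the
  contraction lemma applicable, which keeps the new points in \<open>{l..u}\<close>.\<close>

lemma bracket_step:
  assumes br: "bracket x c"
    and \<kappa>: "0 < \<kappa>" "\<And>y z. y \<in> {l..u} \<Longrightarrow> z \<in> {l..u} \<Longrightarrow> \<kappa> \<le> p' y / p' z"
    and K: "\<And>y z. y \<in> {l..u} \<Longrightarrow> z \<in> {l..u} \<Longrightarrow> \<bar>q' y / p' z\<bar> \<le> K"
  defines "x1 \<equiv> newton_step p x" and "c1 \<equiv> secant_step p x c"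
  shows "bracket x1 c1"
    and "\<bar>x1 - \<xi>\<bar> \<le> (1 - \<kappa>) * \<bar>x - \<xi>\<bar>" and "\<bar>c1 - \<xi>\<bar> \<le> (1 - \<kappa>) * \<bar>c - \<xi>\<bar>"
    and "\<bar>x1 - c1\<bar> \<le> K * \<bar>x - c\<bar>\<^sup>2"
proof -
  have "bracket x1 c1 \<and> \<bar>x1 - \<xi>\<bar> \<le> (1 - \<kappa>) * \<bar>x - \<xi>\<bar> \<and> \<bar>c1 - \<xi>\<bar> \<le> (1 - \<kappa>) * \<bar>c - \<xi>\<bar>
      \<and> \<bar>x1 - c1\<bar> \<le> K * \<bar>x - c\<bar>\<^sup>2"
  proof (cases "x = c")
    case True
    \<comment> \<open>A collapsed bracket is the root itself, which both steps fix by the convention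
      in \<open>secant_step\<close>.\<close>
    with bracket_refl br have "x = \<xi>" "c = \<xi>" by auto
    then show ?thesis
      by (simp add: x1_def c1_def steps_root bracket_root)
  next
    case False
    from br have x: "x \<in> {l..u}" and c: "c \<in> {l..u}"
      and sx: "0 \<le> s * (x - \<xi>)" and sc: "s * (c - \<xi>) \<le> 0"
      by (auto simp: bracket_def)
    have opp: "(x - \<xi>) * (c - \<xi>) \<le> 0"
      using sx sc s_cases by (auto simp: mult_le_0_iff)
    have x1: "x1 - \<xi> = (x - \<xi>)\<^sup>2 * (q' x / p' x)"
      unfolding x1_def using newton_step_error(1)[OF x] .
    have "s * (x1 - \<xi>) = (x - \<xi>)\<^sup>2 * (s * (q' x / p' x))"
      by (simp add: x1)
    with s_quotient_nonneg[OF x x] have sx1: "0 \<le> s * (x1 - \<xi>)"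
      by (metis mult_nonneg_nonneg zero_le_power2)
    obtain \<eta> \<zeta> where \<eta>\<zeta>: "\<eta> \<in> {l..u}" "\<zeta> \<in> {l..u}"
      and c1: "c1 - \<xi> = (x - \<xi>) * (c - \<xi>) * (q' \<eta> / p' \<zeta>)"
      unfolding c1_def using secant_step_error(1)[OF x c False] by blast
    have "s * (c1 - \<xi>) = ((x - \<xi>) * (c - \<xi>)) * (s * (q' \<eta> / p' \<zeta>))"
      by (simp add: c1)
    with opp s_quotient_nonneg[OF \<eta>\<zeta>] have sc1: "s * (c1 - \<xi>) \<le> 0"
      by (metis mult_nonpos_nonneg)
    have sides: "0 \<le> (x - \<xi>) * (x1 - \<xi>)" "0 \<le> (c - \<xi>) * (c1 - \<xi>)"
      using sx sx1 sc sc1 s_cases by (auto simp: zero_le_mult_iff)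
    obtain t where t: "x1 - \<xi> = (x - \<xi>) * (1 - t)" "\<kappa> \<le> t"
      unfolding x1_def using newton_step_error(2)[OF x] \<kappa>(2) by blast
    obtain t' where t': "c1 - \<xi> = (c - \<xi>) * (1 - t')" "\<kappa> \<le> t'"
      unfolding c1_def using secant_step_error(2)[OF x c False] \<kappa>(2) by blast
    note contr_x = contraction_towards_root[OF x t(1) \<kappa>(1) t(2) sides(1)]
      and contr_c = contraction_towards_root[OF c t'(1) \<kappa>(1) t'(2) sides(2)]
    have br1: "bracket x1 c1"
      using contr_x(1) contr_c(1) sx1 sc1 by (simp add: bracket_def)
    have K0: "0 \<le> K" using K[OF x x] by linarith
    have "\<bar>x1 - c1\<bar> = \<bar>x - \<xi>\<bar>\<^sup>2 * \<bar>q' x / p' x\<bar> + (\<bar>x - \<xi>\<bar> * \<bar>c - \<xi>\<bar>) * \<bar>q' \<eta> / p' \<zeta>\<bar>"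
      unfolding bracket_length[OF br1] x1 c1 by (simp add: abs_mult)
    also have "\<dots> \<le> \<bar>x - \<xi>\<bar>\<^sup>2 * K + (\<bar>x - \<xi>\<bar> * \<bar>c - \<xi>\<bar>) * K"
      by (intro add_mono mult_left_mono K x \<eta>\<zeta>) auto
    \<comment> \<open>Both terms share the factor \<open>\<bar>x - \<xi>\<bar>\<close>; the
      remaining distances sum to the old length.\<close>
    also have "\<dots> = K * (\<bar>x - \<xi>\<bar> * \<bar>x - c\<bar>)"
      unfolding bracket_length[OF br] by (simp add: power2_eq_square algebra_simps)
    also have "\<dots> \<le> K * (\<bar>x - c\<bar> * \<bar>x - c\<bar>)"
      using K0 by (intro mult_left_mono mult_right_mono) (auto simp: bracket_length[OF br])
    finally show ?thesis
      using br1 contr_x(2) contr_c(2) by (simp add: power2_eq_square)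
  qed
  then show "bracket x1 c1"
    and "\<bar>x1 - \<xi>\<bar> \<le> (1 - \<kappa>) * \<bar>x - \<xi>\<bar>" and "\<bar>c1 - \<xi>\<bar> \<le> (1 - \<kappa>) * \<bar>c - \<xi>\<bar>"
    and "\<bar>x1 - c1\<bar> \<le> K * \<bar>x - c\<bar>\<^sup>2"
    by simp_all
qed

text \<open>If \<open>l\<close> is the root, the test at \<open>l\<close> fails and Newton starts at
  \<open>u\<close>; the assumption then places \<open>u\<close> on the side selected by
  \<open>s\<close>.\<close>

lemma bracket_start:
  assumes "poly p l = 0 \<Longrightarrow> 0 < poly p u * p'' u"
  shows "bracket (fst (lz1_start p l u)) (snd (lz1_start p l u))"
proof -
  have l: "l \<in> {l..u}" and u: "u \<in> {l..u}" using root_in by auto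
  note sgn_l = p_p''_sign[OF l] and sgn_u = p_p''_sign[OF u]
  show ?thesis
  proof (cases "0 < poly p l * p'' l")
    case True
    \<comment> \<open>As \<open>l \<le> \<xi>\<close>, a positive product at \<open>l\<close> forces
      the selected side to be the left one.\<close>
    with sgn_l have "s = -1"
      using root_in s_cases by (auto simp: sgn_real_def split: if_splits)
    with True l u root_in show ?thesis
      by (simp add: lz1_start_def bracket_def)
  next
    case False
    have "s = 1"
    proof (cases "poly p l = 0")
      case True
      with assms sgn_u root_in s_cases show ?thesis
        by (auto simp: sgn_real_def split: if_splits)
    next
      case nz: False
      with False deriv2_nz[OF l] have "poly p l * p'' l < 0"
        by (metis linorder_neqE_linordered_idom mult_eq_0_iff)
      with sgn_l root_in s_cases show ?thesis
        by (auto simp: sgn_real_def split: if_splits)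
    qed
    with False l u root_in show ?thesis
      by (simp add: lz1_start_def bracket_def)
  qed
qed

section \<open>Convergence of the iteration and its rate\<close>

lemma geometric_convergence:
  fixes y :: "nat \<Rightarrow> real"
  assumes "0 < \<kappa>" "\<kappa> \<le> 1" and step: "\<And>i. \<bar>y (Suc i) - \<xi>\<bar> \<le> (1 - \<kappa>) * \<bar>y i - \<xi>\<bar>"
  shows "y \<longlonglongrightarrow> \<xi>"
proof -
  have bound: "\<bar>y i - \<xi>\<bar> \<le> (1 - \<kappa>) ^ i * \<bar>y 0 - \<xi>\<bar>" for i
  proof (induction i)
    case (Suc i)
    from Suc have "(1 - \<kappa>) * \<bar>y i - \<xi>\<bar> \<le> (1 - \<kappa>) * ((1 - \<kappa>) ^ i * \<bar>y 0 - \<xi>\<bar>)"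
      using assms(2) by (intro mult_left_mono) auto
    with step[of i] show ?case by (simp add: mult.assoc)
  qed simp
  have "(\<lambda>i. (1 - \<kappa>) ^ i * \<bar>y 0 - \<xi>\<bar>) \<longlonglongrightarrow> 0"
    using assms(1,2) by (intro tendsto_mult_left_zero LIMSEQ_realpow_zero) auto
  then have "(\<lambda>i. y i - \<xi>) \<longlonglongrightarrow> 0"
    by (rule Lim_null_comparison[rotated]) (simp add: bound)
  then show ?thesis by (simp add: LIM_zero_iff)
qed

lemma lz1_convergence:
  assumes start: "poly p l = 0 \<Longrightarrow> 0 < poly p u * p'' u"
  defines "x \<equiv> \<lambda>i. fst (lz1_iter p l u i)" and "c \<equiv> \<lambda>i. snd (lz1_iter p l u i)"
  shows "lz1_well_defined p l u" and "x \<longlonglongrightarrow> \<xi>" and "c \<longlonglongrightarrow> \<xi>"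
    and "convergence_rate_at_least 2 (\<lambda>i. \<bar>x i - c i\<bar>)"
proof -
  obtain \<kappa> where \<kappa>: "0 < \<kappa>" "\<And>y z. y \<in> {l..u} \<Longrightarrow> z \<in> {l..u} \<Longrightarrow> \<kappa> \<le> p' y / p' z"
    using p'_quotient_lower_bound by blast
  obtain K where K: "\<And>y z. y \<in> {l..u} \<Longrightarrow> z \<in> {l..u} \<Longrightarrow> \<bar>q' y / p' z\<bar> \<le> K"
    using q'_p'_quotient_upper_bound by blast
  \<comment> \<open>At equal points the quotient bounded below by \<kappa> is 1.\<close>
  have \<kappa>1: "\<kappa> \<le> 1"
    using \<kappa>(2)[OF root_in root_in] deriv_nz[OF root_in] by simp
  have iter_Suc: "x (Suc i) = newton_step p (x i)" "c (Suc i) = secant_step p (x i) (c i)" for i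
    by (simp_all add: x_def c_def split_def Let_def)
  have br: "bracket (x i) (c i)" for i
  proof (induction i)
    case 0
    show ?case using bracket_start[OF start] by (simp add: x_def c_def)
  next
    case (Suc i)
    show ?case unfolding iter_Suc using bracket_step(1)[OF Suc.IH \<kappa> K] .
  qed
  note steps = bracket_step[OF br \<kappa> K, folded iter_Suc]
  show "lz1_well_defined p l u"
    unfolding lz1_well_defined_def
  proof
    fix i
    show "let (x, c) = lz1_iter p l u i in
        p' x \<noteq> 0 \<and> (x \<noteq> c \<longrightarrow> poly p c \<noteq> poly p x)"
      using br[of i] deriv_nz[of "x i"] poly_p_inj[of "x i" "c i"]
      by (simp add: bracket_def x_def c_def split_def Let_def)
  qed
  show x_lim: "x \<longlonglongrightarrow> \<xi>"
    by (rule geometric_convergence[OF \<kappa>(1) \<kappa>1]) (rule steps(2))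
  show c_lim: "c \<longlonglongrightarrow> \<xi>"
    by (rule geometric_convergence[OF \<kappa>(1) \<kappa>1]) (rule steps(3))
  have "(\<lambda>i. \<bar>x i - c i\<bar>) \<longlonglongrightarrow> \<bar>\<xi> - \<xi>\<bar>"
    by (intro tendsto_intros x_lim c_lim)
  \<comment> \<open>On a nonnegative base, zero included, \<open>powr 2\<close> is the square. The
    bound holds from the first index on.\<close>
  moreover have "\<bar>x (Suc i) - c (Suc i)\<bar> \<le> K * \<bar>x i - c i\<bar> powr 2" for i
    using steps(4) by simp
  ultimately show "convergence_rate_at_least 2 (\<lambda>i. \<bar>x i - c i\<bar>)"
    unfolding convergence_rate_at_least_def by (auto intro!: exI[of _ K] always_eventually)
qed

end

theorem theorem5p2:
  fixes f :: "rat poly" and a b :: rat and \<xi> :: real and Iso :: "real set set"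
    and p :: "real poly" and x c :: "nat \<Rightarrow> real"
  assumes "squarefree f"
    and "monotonic_convex_isolation f Iso"
    and "{real_of_rat a..real_of_rat b} \<in> Iso"
    and "a < b" and "a * b > 0"
    and "p = real_poly_of f"
    and "\<xi> \<in> {real_of_rat a..real_of_rat b}" and "poly p \<xi> = 0"
    and "poly p (real_of_rat a) = 0 \<longrightarrow>
           poly p (real_of_rat b) * poly (pderiv (pderiv p)) (real_of_rat b) > 0"
    and "x = (\<lambda>i. fst (lz1_iter p (real_of_rat a) (real_of_rat b) i))"
    and "c = (\<lambda>i. snd (lz1_iter p (real_of_rat a) (real_of_rat b) i))"
  shows "lz1_well_defined p (real_of_rat a) (real_of_rat b) \<and>
         x \<longlonglongrightarrow> \<xi> \<and> c \<longlonglongrightarrow> \<xi> \<and>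
         convergence_rate_at_least 2 (\<lambda>i. \<bar>x i - c i\<bar>)"
proof -
  let ?I = "{real_of_rat a..real_of_rat b}"
  from assms(8) obtain q where q: "p = [:-\<xi>, 1:] * q"
    by (auto simp: poly_eq_0_iff_dvd elim: dvdE)
  \<comment> \<open>Since \<open>a < b\<close>, the interval is not a point, so the isolation
    supplies the nonvanishing of both derivatives on it.\<close>
  have "\<nexists>r. ?I = {r}"
    using assms(4) by (auto simp: atLeastAtMost_singleton_iff of_rat_less_eq)
  with assms(2,3,6) have "\<forall>y\<in>?I. poly (pderiv p) y \<noteq> 0 \<and> poly (pderiv (pderiv p)) y \<noteq> 0"
    unfolding monotonic_convex_isolation_def by blast
  with q assms(7) interpret monotone_convex_root p q "real_of_rat a" "real_of_rat b" \<xi>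
    by unfold_locales auto
  show ?thesis
    using lz1_convergence assms(9-11) by simp
qed

end
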